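(* Let $\alpha\in\mathbb{R}$, $\alpha\neq0$, and let $\mathfrak{g}=\mathfrak{g}_{4.2}^{\alpha}$ be the four-dimensional real Lie algebra with basis $\mathcal{B}=\{e_1,e_2,e_3,e_4\}$ whose nonzero Lie brackets (up to skew-symmetry) are $[e_1,e_4]=\alpha e_1$, $[e_2,e_4]=e_2$, $[e_3,e_4]=e_2+e_3$. Let $\langle\cdot,\cdot\rangle$ be a pseudo-Riemannian inner product on $\mathfrak{g}$ and let $(R_{ij})$ be the matrix of its Ricci operator $\operatorname{Ric}$ in the basis $\mathcal{B}$. If $$R_{32}=0,\quad R_{4i}=0\ (i=1,2,3),\quad R_{33}=R_{22},$$ $$R_{21}+R_{31}=\alpha R_{21},\quad R_{31}=\alpha R_{31},\quad R_{12}=\alpha R_{12},\quad R_{12}+R_{13}=\alpha R_{13},$$ then $\langle\cdot,\cdot\rangle$ is an algebraic Ricci soliton. In this situation, $\operatorname{Ric}=\eta I_4+D$ where $\eta=R_{44}$ and $$D=\begin{bmatrix}R_{11}-R_{44}&R_{12}&R_{13}&R_{14}\\R_{21}&R_{22}-R_{44}&R_{23}&R_{24}\\R_{31}&0&R_{22}-R_{44}&R_{34}\\0&0&0&0\end{bmatrix}$$ is (the matrix in the basis $\mathcal{B}$ of) a derivation of $\mathfrak{g}$. If $R_{21}=R_{31}=R_{12}=R_{13}=0$, the conditions $R_{21}+R_{31}=\alpha R_{21}$, $R_{31}=\alpha R_{31}$, $R_{12}=\alpha R_{12}$, $R_{12}+R_{13}=\alpha R_{13}$ impose no additional condition on $\alpha$;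 but if $R_{31}\neq0$ or $R_{12}\neq0$, then they give $\alpha=1$, which implies that $R_{31}=R_{12}=0$.
   Context: A pseudo-Riemannian inner product on a real Lie algebra $\mathfrak{g}$ is a nondegenerate symmetric bilinear form $\langle\cdot,\cdot\rangle$ on $\mathfrak{g}$ (of some signature $(r,s)$). Its Levi-Civita connection $\nabla$ is defined by $2\langle\nabla_uv,w\rangle=\langle[u,v],w\rangle+\langle[w,u],v\rangle+\langle[w,v],u\rangle$; its curvature is $R_{uv}=\nabla_{[u,v]}-[\nabla_u,\nabla_v]$; its Ricci curvature $\operatorname{ric}(u,v)$ is the trace of $w\mapsto R_{uw}v$; its Ricci operator $\operatorname{Ric}$ is the endomorphism of $\mathfrak{g}$ with $\langle\operatorname{Ric}(u),v\rangle=\operatorname{ric}(u,v)$. The matrix $(R_{ij})$ of $\operatorname{Ric}$ in a basis $\{e_i\}$ is given by $\operatorname{Ric}(e_j)=\sum_iR_{ij}e_i$ (the same column convention is used for $D$). A derivation is a linear map $D:\mathfrak{g}\to\mathfrak{g}$ with $D[x,y]=[D(x),y]+[x,D(y)]$ for all $x,y$. The inner product is an algebraic Ricci soliton if $\operatorname{Ric}=\eta\,\mathrm{Id}_{\mathfrak{g}}+D$ for some $\eta\in\mathbb{R}$ and some derivation $D$ of $\mathfrak{g}$. *)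

theory Defs
  imports "HOL-Analysis.Analysis"
begin

text \<open>
  The underlying vector space is an arbitrary type of class \<^class>\<open>real_vector\<close>; finite
  dimensionality is a consequence of assuming a finite basis. A Lie bracket is an explicit
  function on that type.
\<close>

definition lie_bracket :: "('a::real_vector \<Rightarrow> 'a \<Rightarrow> 'a) \<Rightarrow> bool" where
  "lie_bracket br \<longleftrightarrow> bilinear br \<and> (\<forall>x. br x x = 0) \<and>
     (\<forall>x y z. br x (br y z) + br y (br z x) + br z (br x y) = 0)"

definition is_derivation :: "('a::real_vector \<Rightarrow> 'a \<Rightarrow> 'a) \<Rightarrow> ('a \<Rightarrow> 'a) \<Rightarrow> bool" where
  "is_derivation br D \<longleftrightarrow> linear D \<and> (\<forall>x y. D (br x y) = br (D x) y + br x (D y))"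

definition pseudo_inner :: "('a::real_vector \<Rightarrow> 'a \<Rightarrow> real) \<Rightarrow> bool" where
  "pseudo_inner ip \<longleftrightarrow> bilinear ip \<and> (\<forall>x y. ip x y = ip y x) \<and>
     (\<forall>x. (\<forall>y. ip x y = 0) \<longrightarrow> x = 0)"

definition indexed_basis :: "('n \<Rightarrow> 'a::real_vector) \<Rightarrow> bool" where
  "indexed_basis e \<longleftrightarrow> inj e \<and> independent (range e) \<and> span (range e) = UNIV"

text \<open>Column convention: \<open>f (e j) = (\<Sum>i. matrix_in e f $ i $ j *\<^sub>R e i)\<close>.\<close>

definition matrix_in :: "('n::finite \<Rightarrow> 'a::real_vector) \<Rightarrow> ('a \<Rightarrow> 'a) \<Rightarrow> real^'n^'n" where
  "matrix_in e f = (\<chi> i j. representation (range e) (f (e j)) (e i))"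

definition endo_of :: "('n::finite \<Rightarrow> 'a::real_vector) \<Rightarrow> real^'n^'n \<Rightarrow> 'a \<Rightarrow> 'a" where
  "endo_of e M v = (\<Sum>j\<in>UNIV. representation (range e) v (e j) *\<^sub>R (\<Sum>i\<in>UNIV. M $ i $ j *\<^sub>R e i))"

text \<open>
  The trace of an endomorphism of a finite-dimensional space, computed in an arbitrarily chosen
  basis; for linear \<open>f\<close> the value does not depend on the choice.
\<close>

definition endo_trace :: "('a::real_vector \<Rightarrow> 'a) \<Rightarrow> real" where
  "endo_trace f =
     (let B = (SOME B. independent B \<and> span B = UNIV) in \<Sum>b\<in>B. representation B (f b) b)"

text \<open>
  In finite dimension, nondegeneracy of \<open>ip\<close> makes the vectors described by \<open>THE\<close> below exist
  and be unique.
\<close>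

definition levi_civita ::
  "('a::real_vector \<Rightarrow> 'a \<Rightarrow> 'a) \<Rightarrow> ('a \<Rightarrow> 'a \<Rightarrow> real) \<Rightarrow> 'a \<Rightarrow> 'a \<Rightarrow> 'a" where
  "levi_civita br ip u v =
     (THE x. \<forall>w. 2 * ip x w = ip (br u v) w + ip (br w u) v + ip (br w v) u)"

definition curvature ::
  "('a::real_vector \<Rightarrow> 'a \<Rightarrow> 'a) \<Rightarrow> ('a \<Rightarrow> 'a \<Rightarrow> real) \<Rightarrow> 'a \<Rightarrow> 'a \<Rightarrow> 'a \<Rightarrow> 'a" where
  "curvature br ip u v x =
     levi_civita br ip (br u v) x
     - (levi_civita br ip u (levi_civita br ip v x) - levi_civita br ip v (levi_civita br ip u x))"

definition ricci ::
  "('a::real_vector \<Rightarrow> 'a \<Rightarrow> 'a) \<Rightarrow> ('a \<Rightarrow> 'a \<Rightarrow> real) \<Rightarrow> 'a \<Rightarrow> 'a \<Rightarrow> real" where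
  "ricci br ip u v = endo_trace (\<lambda>w. curvature br ip u w v)"

definition ricci_operator ::
  "('a::real_vector \<Rightarrow> 'a \<Rightarrow> 'a) \<Rightarrow> ('a \<Rightarrow> 'a \<Rightarrow> real) \<Rightarrow> 'a \<Rightarrow> 'a" where
  "ricci_operator br ip u = (THE x. \<forall>v. ip x v = ricci br ip u v)"

definition algebraic_ricci_soliton ::
  "('a::real_vector \<Rightarrow> 'a \<Rightarrow> 'a) \<Rightarrow> ('a \<Rightarrow> 'a \<Rightarrow> real) \<Rightarrow> bool" where
  "algebraic_ricci_soliton br ip \<longleftrightarrow>
     (\<exists>(\<eta>::real) D. is_derivation br D \<and> (\<forall>u. ricci_operator br ip u = \<eta> *\<^sub>R u + D u))"

text \<open>In the index type \<^typ>\<open>4\<close> the numeral \<open>4\<close> denotes the same element as \<open>0\<close>, so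
  \<open>1, 2, 3, 4\<close> are its four distinct elements.\<close>

definition is_g42 ::
  "real \<Rightarrow> ('a::real_vector \<Rightarrow> 'a \<Rightarrow> 'a) \<Rightarrow> (4 \<Rightarrow> 'a) \<Rightarrow> bool" where
  "is_g42 \<alpha> br e \<longleftrightarrow> lie_bracket br \<and> indexed_basis e \<and>
     br (e 1) (e 4) = \<alpha> *\<^sub>R e 1 \<and> br (e 2) (e 4) = e 2 \<and> br (e 3) (e 4) = e 2 + e 3 \<and>
     br (e 1) (e 2) = 0 \<and> br (e 1) (e 3) = 0 \<and> br (e 2) (e 3) = 0"

definition g42_alpha_conditions :: "real \<Rightarrow> real^4^4 \<Rightarrow> bool" where
  "g42_alpha_conditions \<alpha> R \<longleftrightarrow>
     R$2$1 + R$3$1 = \<alpha> * R$2$1 \<and> R$3$1 = \<alpha> * R$3$1 \<and>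
     R$1$2 = \<alpha> * R$1$2 \<and> R$1$2 + R$1$3 = \<alpha> * R$1$3"

definition g42_D :: "real^4^4 \<Rightarrow> real^4^4" where
  "g42_D R = vector [
     vector [R$1$1 - R$4$4, R$1$2,          R$1$3,          R$1$4],
     vector [R$2$1,         R$2$2 - R$4$4,  R$2$3,          R$2$4],
     vector [R$3$1,         0,              R$2$2 - R$4$4,  R$3$4],
     vector [0,             0,              0,              0]]"

end

theory Submission
  imports Defs
begin

text \<open>
  Nondegeneracy and a finite basis give a Riesz representation, so the vectors described by
  \<open>THE\<close> in \<open>levi_civita\<close> and \<open>ricci_operator\<close> exist and the Ricci operator is linear, hence
  determined by its matrix. The derivation property is then a coefficient comparison on the
  brackets of basis vectors: \<open>[e\<^sub>1, e\<^sub>4]\<close> uses the first two conditions on \<open>\<alpha>\<close>, \<open>[e\<^sub>2, e\<^sub>4]\<close>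
  the third and \<open>[e\<^sub>3, e\<^sub>4]\<close> the fourth; the vanishing last row of \<open>D\<close> takes care of the
  other brackets because \<open>e\<^sub>1, e\<^sub>2, e\<^sub>3\<close> commute.
\<close>

section \<open>Nondegenerate forms and representation of linear functionals\<close>

lemma pseudo_inner_eqI:
  assumes "pseudo_inner ip" and "\<And>w. ip x w = ip y w"
  shows "x = y"
proof -
  have bil: "bilinear ip" using assms(1) by (simp add: pseudo_inner_def)
  have "ip (x - y) w = 0" for w
    using assms(2) by (simp add: bilinear_lsub[OF bil])
  then show ?thesis using assms(1) unfolding pseudo_inner_def
    by (metis eq_iff_diff_eq_0)
qed

text \<open>Nondegeneracy makes the map from \<open>x\<close> to the functional \<open>ip x\<close>
  injective, and in finite dimension injectivity forces surjectivity.\<close>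

lemma pseudo_inner_riesz:
  fixes e :: "'n::finite \<Rightarrow> 'a::real_vector" and f :: "'a \<Rightarrow> real"
  assumes e: "indexed_basis e" and ip: "pseudo_inner ip" and f: "linear f"
  shows "\<exists>!x. \<forall>w. ip x w = f w"
proof -
  have inj: "inj e" and ind: "independent (range e)" and spn: "span (range e) = UNIV"
    using e by (auto simp: indexed_basis_def)
  have bil: "bilinear ip" using ip by (simp add: pseudo_inner_def)
  have ext: "g = h" if "linear g" "linear h" "\<And>i. g (e i) = h (e i)" for g h :: "'a \<Rightarrow> real"
    using linear_eq_on_span[OF that(1,2), of "range e"] that(3) spn by auto
  have coeff: "c = d"
    if "(\<Sum>i\<in>UNIV. c i *\<^sub>R e i) = (\<Sum>i\<in>UNIV. d i *\<^sub>R e i)" for c d :: "'n \<Rightarrow> real"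
  proof
    fix i
    \<comment> \<open>Independence speaks of the set \<open>range e\<close>, so the indexed
      coefficients are carried over along \<open>inv e\<close>.\<close>
    have "(\<Sum>b\<in>range e. (c (inv e b) - d (inv e b)) *\<^sub>R b) = 0"
      using that by (simp add: sum.reindex[OF inj] inj algebra_simps sum_subtractf)
    then have "c (inv e (e i)) - d (inv e (e i)) = 0"
      using independentD[OF ind _ order.refl, of "\<lambda>b. c (inv e b) - d (inv e b)" "e i"] by simp
    then show "c i = d i" by (simp add: inj)
  qed
  \<comment> \<open>The values of \<open>ip x\<close> on the basis are stored as coordinates, which
    turns the map into the dual space into an endomorphism of \<open>'a\<close>.\<close>
  define g where "g x = (\<Sum>i\<in>UNIV. ip x (e i) *\<^sub>R e i)" for x
  have lin: "linear g"
    by (rule linearI)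
      (simp_all add: g_def bilinear_ladd[OF bil] bilinear_lmul[OF bil] algebra_simps
        sum.distrib scaleR_sum_right)
  have "inj g"
  proof (rule injI)
    fix x y assume "g x = g y"
    then have "(\<lambda>i. ip x (e i)) = (\<lambda>i. ip y (e i))"
      unfolding g_def by (rule coeff)
    then have "ip x = ip y"
      using bil by (intro ext) (auto simp: bilinear_def fun_eq_iff)
    then show "x = y" using pseudo_inner_eqI[OF ip] by metis
  qed
  interpret fd: finite_dimensional_vector_space scaleR "range e"
    using ind spn unfolding dependent_raw_def span_raw_def by unfold_locales simp_all
  have "surj g" using fd.linear_inj_imp_surj lin \<open>inj g\<close> by (simp add: linear_def)
  then obtain x where "g x = (\<Sum>i\<in>UNIV. f (e i) *\<^sub>R e i)" by (metis surjD)
  then have "(\<lambda>i. ip x (e i)) = (\<lambda>i. f (e i))" unfolding g_def by (rule coeff)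
  then have "ip x = f" using bil f by (intro ext) (auto simp: bilinear_def fun_eq_iff)
  then show ?thesis using pseudo_inner_eqI[OF ip] by metis
qed

section \<open>Levi-Civita connection, Ricci curvature and Ricci operator\<close>

lemma levi_civita_eq:
  fixes e :: "'n::finite \<Rightarrow> 'a::real_vector" and ip :: "'a \<Rightarrow> 'a \<Rightarrow> real"
  assumes "indexed_basis e" "pseudo_inner ip" "bilinear br"
  shows "2 * ip (levi_civita br ip u v) w = ip (br u v) w + ip (br w u) v + ip (br w v) u"
proof -
  have bil: "bilinear ip" using assms(2) by (simp add: pseudo_inner_def)
  note simps = bilinear_ladd[OF bil] bilinear_lmul[OF bil] bilinear_radd[OF bil]
    bilinear_rmul[OF bil] bilinear_ladd[OF assms(3)] bilinear_lmul[OF assms(3)]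
  \<comment> \<open>Half the right-hand side of the Koszul formula is the functional that
    \<open>levi_civita br ip u v\<close> represents.\<close>
  have "linear (\<lambda>w. (ip (br u v) w + ip (br w u) v + ip (br w v) u) / 2)"
    by (rule linearI) (simp_all add: simps field_simps)
  from pseudo_inner_riesz[OF assms(1,2) this]
  have "\<exists>!x. \<forall>w. 2 * ip x w = ip (br u v) w + ip (br w u) v + ip (br w v) u"
    by (simp add: field_simps)
  from theI'[OF this] show ?thesis unfolding levi_civita_def by blast
qed

text \<open>Paired with any \<open>w\<close>, the Koszul formula is bilinear in \<open>u\<close> and
  \<open>v\<close>; nondegeneracy lifts this to vectors.\<close>

lemma bilinear_levi_civita:
  fixes e :: "'n::finite \<Rightarrow> 'a::real_vector" and ip :: "'a \<Rightarrow> 'a \<Rightarrow> real"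
  assumes "indexed_basis e" "pseudo_inner ip" "bilinear br"
  shows "bilinear (levi_civita br ip)"
proof -
  have bil: "bilinear ip" using assms(2) by (simp add: pseudo_inner_def)
  note simps = bilinear_ladd[OF bil] bilinear_lmul[OF bil] bilinear_radd[OF bil]
    bilinear_rmul[OF bil] bilinear_ladd[OF assms(3)] bilinear_lmul[OF assms(3)]
    bilinear_radd[OF assms(3)] bilinear_rmul[OF assms(3)]
  note lc = levi_civita_eq[OF assms]
  have eqI: "x = y" if "\<And>w. 2 * ip x w = 2 * ip y w" for x y
    using that by (intro pseudo_inner_eqI[OF assms(2)]) simp
  let ?L = "levi_civita br ip"
  have "?L (u + u') v = ?L u v + ?L u' v" for u u' v
    by (rule eqI) (simp add: simps lc distrib_left)
  moreover have "?L u (v + v') = ?L u v + ?L u v'" for u v v'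
    by (rule eqI) (simp add: simps lc distrib_left)
  \<comment> \<open>Moving the factor 2 past \<open>c\<close> restores the left-hand side of
    \<open>lc\<close>, so that it can rewrite.\<close>
  moreover have "?L (c *\<^sub>R u) v = c *\<^sub>R ?L u v" for c u v
    by (rule eqI) (simp add: simps mult.left_commute[of 2] lc distrib_left)
  moreover have "?L u (c *\<^sub>R v) = c *\<^sub>R ?L u v" for c u v
    by (rule eqI) (simp add: simps mult.left_commute[of 2] lc distrib_left)
  ultimately show ?thesis by (auto simp: bilinear_def intro!: linearI)
qed

text \<open>The choice in \<open>endo_trace\<close> does not depend on the endomorphism, so all
  traces here are sums over the same \<open>B\<close>, and coordinates in \<open>B\<close> are
  linear. The basis \<open>e\<close> guarantees that the choice succeeds.\<close>

lemma endo_trace_linear: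
  assumes "indexed_basis (e :: 'n::finite \<Rightarrow> 'a::real_vector)"
  shows "endo_trace (\<lambda>w. f w + g w) = endo_trace f + endo_trace (g :: 'a \<Rightarrow> 'a)"
    and "endo_trace (\<lambda>w. c *\<^sub>R f w) = c * endo_trace f"
proof -
  define B where "B = (SOME B :: 'a set. independent B \<and> span B = UNIV)"
  have "independent B \<and> span B = UNIV"
    unfolding B_def by (rule someI[of _ "range e"]) (use assms in \<open>simp add: indexed_basis_def\<close>)
  then show "endo_trace (\<lambda>w. f w + g w) = endo_trace f + endo_trace g"
    and "endo_trace (\<lambda>w. c *\<^sub>R f w) = c * endo_trace f"
    by (simp_all add: endo_trace_def B_def[symmetric] representation_add representation_scale
        sum.distrib sum_distrib_left)
qed

text \<open>For each fixed \<open>w\<close> the curvature is linear in its first and third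
  arguments, and the trace over \<open>w\<close> preserves this.\<close>

lemma bilinear_ricci:
  fixes e :: "'n::finite \<Rightarrow> 'a::real_vector" and ip :: "'a \<Rightarrow> 'a \<Rightarrow> real"
  assumes "indexed_basis e" "pseudo_inner ip" "bilinear br"
  shows "bilinear (ricci br ip)"
proof -
  note L = bilinear_levi_civita[OF assms]
  note simps = bilinear_ladd[OF L] bilinear_lmul[OF L] bilinear_radd[OF L] bilinear_rmul[OF L]
    bilinear_ladd[OF assms(3)] bilinear_lmul[OF assms(3)]
  have "curvature br ip (u + u') w v = curvature br ip u w v + curvature br ip u' w v"
    "curvature br ip u w (v + v') = curvature br ip u w v + curvature br ip u w v'"
    "curvature br ip (c *\<^sub>R u) w v = c *\<^sub>R curvature br ip u w v"
    "curvature br ip u w (c *\<^sub>R v) = c *\<^sub>R curvature br ip u w v"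
    for u u' v v' w c
    by (simp_all add: curvature_def simps algebra_simps)
  then show ?thesis
    by (auto simp: bilinear_def ricci_def endo_trace_linear[OF assms(1)] intro!: linearI)
qed

lemma linear_ricci_operator:
  fixes e :: "'n::finite \<Rightarrow> 'a::real_vector" and ip :: "'a \<Rightarrow> 'a \<Rightarrow> real"
  assumes "indexed_basis e" "pseudo_inner ip" "bilinear br"
  shows "linear (ricci_operator br ip)"
proof -
  note ric = bilinear_ricci[OF assms]
  have bil: "bilinear ip" using assms(2) by (simp add: pseudo_inner_def)
  have "\<exists>!x. \<forall>v. ip x v = ricci br ip u v" for u
    using ric by (intro pseudo_inner_riesz[OF assms(1,2)]) (simp add: bilinear_def)
  from theI'[OF this] have op: "ip (ricci_operator br ip u) v = ricci br ip u v" for u v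
    unfolding ricci_operator_def by blast
  show ?thesis
    by (rule linearI; rule pseudo_inner_eqI[OF assms(2)])
      (simp_all add: bilinear_ladd[OF bil] bilinear_lmul[OF bil] op
        bilinear_ladd[OF ric] bilinear_lmul[OF ric])
qed

section \<open>Passage between endomorphisms and matrices\<close>

lemma linear_endo_of:
  assumes "indexed_basis e"
  shows "linear (endo_of e M)"
  using assms unfolding indexed_basis_def
  by (intro linearI) (simp_all add: endo_of_def representation_add representation_scale
      distrib_right mult.assoc scaleR_left_distrib sum.distrib scaleR_sum_right)

lemma endo_of_basis:
  assumes "indexed_basis e"
  shows "endo_of e M (e j) = (\<Sum>i\<in>UNIV. M $ i $ j *\<^sub>R e i)"
proof -
  have "inj e" "independent (range e)" using assms by (auto simp: indexed_basis_def)
  then have "representation (range e) (e j) (e k) = (if k = j then 1 else 0)" for k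
    by (auto simp: representation_basis inj_eq)
  then show ?thesis by (simp add: endo_of_def if_distrib[of "\<lambda>c. c *\<^sub>R _"] cong: if_cong)
qed

lemma indexed_basis_linear_ext:
  assumes "indexed_basis e" "linear f" "linear g" "\<And>i. f (e i) = g (e i)"
  shows "f u = g u"
  using linear_eq_on_span[OF assms(2,3), of "range e" u] assms(1,4)
  by (auto simp: indexed_basis_def)

lemma endo_of_matrix_in:
  fixes e :: "'n::finite \<Rightarrow> 'a::real_vector"
  assumes e: "indexed_basis e" and f: "linear f"
  shows "endo_of e (matrix_in e f) u = f u"
proof (rule indexed_basis_linear_ext[OF e linear_endo_of[OF e] f])
  fix j
  have inj: "inj e" and "independent (range e)" "span (range e) = UNIV"
    using e by (auto simp: indexed_basis_def)
  then have "(\<Sum>b\<in>range e. representation (range e) (f (e j)) b *\<^sub>R b) = f (e j)"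
    by (intro sum_representation_eq) auto
  then show "endo_of e (matrix_in e f) (e j) = f (e j)"
    by (simp add: endo_of_basis[OF e] matrix_in_def sum.reindex[OF inj])
qed

text \<open>Turns a matrix identity R = \<eta> I + D into the corresponding identity of
  operators.\<close>

lemma endo_of_scaleR_mat_add:
  fixes e :: "'n::finite \<Rightarrow> 'a::real_vector"
  assumes e: "indexed_basis e"
  shows "endo_of e (c *\<^sub>R mat 1 + M) u = c *\<^sub>R u + endo_of e M u"
proof (rule indexed_basis_linear_ext[OF e linear_endo_of[OF e]])
  show "linear (\<lambda>u. c *\<^sub>R u + endo_of e M u)"
    by (intro linear_compose_add linear_endo_of[OF e] linear_scale_self)
  fix j
  have "(\<Sum>i\<in>UNIV. (c * (if i = j then 1 else 0)) *\<^sub>R e i) = (\<Sum>i\<in>UNIV. if i = j then c *\<^sub>R e i else 0)"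
    by (intro sum.cong) auto
  then show "endo_of e (c *\<^sub>R mat 1 + M) (e j) = c *\<^sub>R e j + endo_of e M (e j)"
    by (simp add: endo_of_basis[OF e] mat_def scaleR_left_distrib sum.distrib)
qed

section \<open>Derivations and the algebraic soliton condition\<close>

lemma is_derivation_basisI:
  assumes e: "indexed_basis e" and br: "bilinear br" and D: "linear D"
    and *: "\<And>i j. D (br (e i) (e j)) = br (D (e i)) (e j) + br (e i) (D (e j))"
  shows "is_derivation br D"
proof -
  \<comment> \<open>Both sides of the Leibniz rule are bilinear, so agreement on pairs of basis
    vectors suffices.\<close>
  have "bilinear (\<lambda>x y. D (br x y))" "bilinear (\<lambda>x y. br (D x) y + br x (D y))"
    by (auto simp: bilinear_def linear_iff linear_add[OF D] linear_scale[OF D] bilinear_ladd[OF br]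
        bilinear_radd[OF br] bilinear_lmul[OF br] bilinear_rmul[OF br] algebra_simps)
  from bilinear_eq[OF this, of UNIV "range e" UNIV "range e"] e *
  have "D (br x y) = br (D x) y + br x (D y)" for x y
    by (auto simp: indexed_basis_def)
  then show ?thesis using D by (simp add: is_derivation_def)
qed

lemma lie_bracket_anticommute:
  assumes "lie_bracket br"
  shows "br x y = - br y x"
proof -
  have bil: "bilinear br" and z: "br z z = 0" for z using assms by (auto simp: lie_bracket_def)
  have "br y x + br x y = 0"
    using z[of "x + y"] z[of x] z[of y] by (simp add: bilinear_ladd[OF bil] bilinear_radd[OF bil])
  then show ?thesis by (simp add: eq_neg_iff_add_eq_0 add.commute)
qed

lemma vector_4:
  "(vector [w, x, y, z] :: 'a::zero^4) $ 1 = w"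
  "(vector [w, x, y, z] :: 'a::zero^4) $ 2 = x"
  "(vector [w, x, y, z] :: 'a::zero^4) $ 3 = y"
  "(vector [w, x, y, z] :: 'a::zero^4) $ 4 = z"
  by (simp_all add: vector_def)

lemma g42_D_nth:
  "g42_D R $ 1 $ 1 = R$1$1 - R$4$4" "g42_D R $ 1 $ 2 = R$1$2" "g42_D R $ 1 $ 3 = R$1$3"
  "g42_D R $ 1 $ 4 = R$1$4"
  "g42_D R $ 2 $ 1 = R$2$1" "g42_D R $ 2 $ 2 = R$2$2 - R$4$4" "g42_D R $ 2 $ 3 = R$2$3"
  "g42_D R $ 2 $ 4 = R$2$4"
  "g42_D R $ 3 $ 1 = R$3$1" "g42_D R $ 3 $ 2 = 0" "g42_D R $ 3 $ 3 = R$2$2 - R$4$4"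
  "g42_D R $ 3 $ 4 = R$3$4"
  "g42_D R $ 4 $ j = 0"
  using exhaust_4[of j] by (auto simp: g42_D_def vector_4)

lemma is_derivation_g42_D:
  assumes g: "is_g42 \<alpha> br e" and R: "g42_alpha_conditions \<alpha> R"
  shows "is_derivation br (endo_of e (g42_D R))"
proof -
  have lie: "lie_bracket br" and e: "indexed_basis e" using g by (auto simp: is_g42_def)
  then have br: "bilinear br" and z: "\<And>x. br x x = 0" by (auto simp: lie_bracket_def)
  let ?D = "endo_of e (g42_D R)"
  have D: "linear ?D" by (rule linear_endo_of[OF e])
  note anti = lie_bracket_anticommute[OF lie]
  have brk: "br (e 1) (e 4) = \<alpha> *\<^sub>R e 1" "br (e 2) (e 4) = e 2" "br (e 3) (e 4) = e 2 + e 3"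
    "br (e 1) (e 2) = 0" "br (e 1) (e 3) = 0" "br (e 2) (e 3) = 0"
    using g by (auto simp: is_g42_def)
  then have brk': "br (e 4) (e 1) = - (\<alpha> *\<^sub>R e 1)" "br (e 4) (e 2) = - e 2"
    "br (e 4) (e 3) = - (e 2 + e 3)" "br (e 2) (e 1) = 0" "br (e 3) (e 1) = 0" "br (e 3) (e 2) = 0"
    using anti by (metis neg_equal_0_iff_equal)+
  \<comment> \<open>The zero last row leaves no \<open>e 4\<close> term: \<open>?D\<close> maps into
    the abelian ideal spanned by \<open>e 1\<close>, \<open>e 2\<close>, \<open>e 3\<close>.\<close>
  have De: "?D (e j) = g42_D R $ 1 $ j *\<^sub>R e 1 + g42_D R $ 2 $ j *\<^sub>R e 2 + g42_D R $ 3 $ j *\<^sub>R e 3" for j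
    by (simp add: endo_of_basis[OF e] sum_4 g42_D_nth)
  note simps = De g42_D_nth linear_add[OF D] linear_scale[OF D] linear_neg[OF D] linear_0[OF D]
    bilinear_ladd[OF br] bilinear_radd[OF br] bilinear_lmul[OF br] bilinear_rmul[OF br]
    z
  \<comment> \<open>As rewrite rules these remove products of \<alpha> with off-diagonal entries;
    the first and fourth are reversed when used.\<close>
  have c: "R$2$1 + R$3$1 = \<alpha> * R$2$1" "\<alpha> * R$3$1 = R$3$1"
    "\<alpha> * R$1$2 = R$1$2" "R$1$2 + R$1$3 = \<alpha> * R$1$3"
    using R by (auto simp: g42_alpha_conditions_def)
  let ?P = "\<lambda>x y. ?D (br x y) = br (?D x) y + br x (?D y)"
  have 14: "?P (e 1) (e 4)"
    by (simp add: simps brk brk' scaleR_right_distrib c(1)[symmetric] c(2)) (simp add: algebra_simps)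
  have 24: "?P (e 2) (e 4)"
    by (simp add: simps brk brk' scaleR_right_distrib c(3) mult.commute)
  have 34: "?P (e 3) (e 4)"
    by (simp add: simps brk brk' scaleR_right_distrib mult.commute[of _ \<alpha>] c(4)[symmetric])
      (simp add: algebra_simps)
  have less: "?P (e 1) (e 2)" "?P (e 1) (e 3)" "?P (e 2) (e 3)"
    by (simp_all add: simps brk brk')
  \<comment> \<open>Skew-symmetry reduces the sixteen basis pairs to the six above the diagonal and
    the diagonal ones. From here on \<open>sym\<close> is this fact, not symmetry of
    equality.\<close>
  have sym: "?P y x" if "?P x y" for x y
    using that anti[of y x] anti[of "?D y" x] anti[of y "?D x"] by (simp add: linear_neg[OF D])
  have "?P x x" for x
    using anti[of "?D x" x] by (simp add: z linear_0[OF D])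
  then have "?P (e i) (e j)" for i j
    using exhaust_4[of i] exhaust_4[of j] 14 24 34 less
      sym[OF 14] sym[OF 24] sym[OF 34] less[THEN sym] by fast
  then show ?thesis by (rule is_derivation_basisI[OF e br D])
qed

theorem theorem4p2:
  fixes \<alpha> :: real
    and br :: "'a::real_vector \<Rightarrow> 'a \<Rightarrow> 'a"
    and e :: "4 \<Rightarrow> 'a"
    and ip :: "'a \<Rightarrow> 'a \<Rightarrow> real"
    and R :: "real^4^4"
  assumes "\<alpha> \<noteq> 0"
    and "is_g42 \<alpha> br e"
    and "pseudo_inner ip"
    and "R = matrix_in e (ricci_operator br ip)"
  shows "(R$3$2 = 0 \<and> (\<forall>i\<in>{1, 2, 3}. R$4$i = 0) \<and> R$3$3 = R$2$2 \<and> g42_alpha_conditions \<alpha> R \<longrightarrow>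
            algebraic_ricci_soliton br ip \<and>
            is_derivation br (endo_of e (g42_D R)) \<and>
            (\<forall>u. ricci_operator br ip u = R$4$4 *\<^sub>R u + endo_of e (g42_D R) u) \<and>
            R = R$4$4 *\<^sub>R mat 1 + g42_D R)
       \<and> (R$2$1 = 0 \<and> R$3$1 = 0 \<and> R$1$2 = 0 \<and> R$1$3 = 0 \<longrightarrow>
            (\<forall>\<beta>. g42_alpha_conditions \<beta> R))
       \<and> (g42_alpha_conditions \<alpha> R \<longrightarrow>
            (R$3$1 \<noteq> 0 \<or> R$1$2 \<noteq> 0 \<longrightarrow> \<alpha> = 1) \<and>
            (\<alpha> = 1 \<longrightarrow> R$3$1 = 0 \<and> R$1$2 = 0))"
\<comment> \<open>The instantiated patterns separate the three implications but keep the conclusion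
  of the first as a single conjunction.\<close>
proof (intro conjI[of "_ \<longrightarrow> _"] impI[of "_ \<and> _"])
  let ?Ric = "ricci_operator br ip"
  have e: "indexed_basis e" and br: "bilinear br"
    using assms(2) by (auto simp: is_g42_def lie_bracket_def)
  assume A: "R$3$2 = 0 \<and> (\<forall>i\<in>{1, 2, 3}. R$4$i = 0) \<and> R$3$3 = R$2$2 \<and> g42_alpha_conditions \<alpha> R"
  then have D: "is_derivation br (endo_of e (g42_D R))"
    using is_derivation_g42_D[OF assms(2)] by blast
  \<comment> \<open>Entrywise, the conditions on \<open>R$3$2\<close>, \<open>R$3$3\<close> and the
    last row supply exactly the entries where \<open>g42_D R\<close> is not read off from
    \<open>R\<close> directly.\<close>
  have R_eq: "R = R$4$4 *\<^sub>R mat 1 + g42_D R"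
    using A by (simp add: vec_eq_iff forall_4 mat_def g42_D_nth)
  have "?Ric u = endo_of e R u" for u
    using endo_of_matrix_in[OF e linear_ricci_operator[OF e assms(3) br]] assms(4) by simp
  then have Ric: "?Ric u = R$4$4 *\<^sub>R u + endo_of e (g42_D R) u" for u
    using endo_of_scaleR_mat_add[OF e, of "R$4$4" "g42_D R" u] R_eq by simp
  show "algebraic_ricci_soliton br ip \<and> is_derivation br (endo_of e (g42_D R)) \<and>
      (\<forall>u. ?Ric u = R$4$4 *\<^sub>R u + endo_of e (g42_D R) u) \<and> R = R$4$4 *\<^sub>R mat 1 + g42_D R"
    using D Ric R_eq unfolding algebraic_ricci_soliton_def by blast
\<comment> \<open>Zero entries satisfy the conditions for every \<beta>. Cancelling a nonzero
  \<open>R$3$1\<close> or \<open>R$1$2\<close> in the second or third condition gives \<alpha> = 1,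
  and \<alpha> = 1 in the first and fourth makes both entries vanish.\<close>
qed (auto simp: g42_alpha_conditions_def)

end
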